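(* Let $E$ be a locally compact Polish space. Let $\Theta,\Xi$ be independent point processes on $E$ with $\Theta$ of type $\mathcal{C}_{non\text{-}vanishing}$ and $\Xi$ of type $\mathcal{C}_{zero}$, and let $\Theta',\Xi'$ be another independent pair with $\Theta'$ of type $\mathcal{C}_{non\text{-}vanishing}$ and $\Xi'$ of type $\mathcal{C}_{zero}$. If $\Theta+\Xi\stackrel{d}{=}\Theta'+\Xi'$, then $\Theta\stackrel{d}{=}\Theta'$ and $\Xi\stackrel{d}{=}\Xi'$. That is, the independent superposition $\Theta+\Xi$ determines uniquely the distributions of $\Theta$ and of $\Xi$.
   Context: A point process on $E$ is a random Radon measure on $E$ with values in $\mathbb{N}\cup\{\infty\}$; the sum of independent point processes is the sum of the random measures. $\mathcal{B}_c(E)$ is the set of bounded Borel functions $\varphi:E\to\mathbb{C}$ with compact support. $\mathcal{C}$ is the class of point processes $\Lambda$ on $E$ for which the probability generating functional $\mathscr{B}_\Lambda(\varphi)=\mathbb{E}\big(\prod_{x\in E}(1+\varphi(x))^{\Lambda(\{x\})}\big)$ is well defined for all $\varphi\in\mathcal{B}_c(E)$; equivalently $\mathbb{E}(a^{\Lambda(B)})<\infty$ for every relatively compact Borel $B\subset E$ and every $a>0$. For $\Lambda\in\mathcal{C}$ and $\varphi\in\mathcal{B}_c(E)$, $z\mapsto\mathscr{B}_\Lambda(z\varphi)$ is entire. $\mathcal{C}_{non\text{-}vanishing}$ is the subclass of $\Theta\in\mathcal{C}$ such that for every $\varphi\in\mathcal{B}_c(E)$ the entire function $z\mapsto\mathscr{B}_\Theta(z\varphi)$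 has no zeros in $\mathbb{C}$. $\mathcal{C}_{zero}$ is the subclass of $\Xi\in\mathcal{C}$ such that for every $\varphi\in\mathcal{B}_c(E)$ the entire function $z\mapsto\mathscr{B}_\Xi(z\varphi)$ is uniquely determined by its zeros (counted with multiplicity), understood as: if $\Xi,\Xi'$ are of type $\mathcal{C}_{zero}$ and for some $\varphi$ the functions $z\mapsto\mathscr{B}_\Xi(z\varphi)$ and $z\mapsto\mathscr{B}_{\Xi'}(z\varphi)$ have the same zeros with multiplicities, then these two functions coincide. *)

theory Defs
  imports "HOL-Probability.Probability" "HOL-Complex_Analysis.Complex_Analysis"
begin

definition counting_radon :: "'e::topological_space measure set" where
  "counting_radon =
     {N. sets N = sets (borel :: 'e measure) \<and>
         (\<forall>A\<in>sets N. \<exists>n::nat. emeasure N A = of_nat n \<or> emeasure N A = \<infinity>) \<and>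
         (\<forall>K. compact K \<longrightarrow> emeasure N K < \<infinity>)}"

definition config_space :: "'e::topological_space measure measure" where
  "config_space = sigma counting_radon
     {{N \<in> counting_radon. emeasure N A \<in> X} | A X.
        A \<in> sets (borel :: 'e measure) \<and> X \<in> sets (borel :: ennreal measure)}"

definition config_add :: "'e::topological_space measure \<Rightarrow> 'e measure \<Rightarrow> 'e measure" where
  "config_add N1 N2 = measure_of UNIV (sets (borel :: 'e measure))
       (\<lambda>A. emeasure N1 A + emeasure N2 A)"

text \<open>Multiplicity N({x}) of a point x (finite for configurations, since singletons
  are compact).\<close>

definition point_mult :: "'e::topological_space measure \<Rightarrow> 'e \<Rightarrow> nat" where
  "point_mult N x = nat \<lfloor>measure N {x}\<rfloor>"

definition Bc :: "('e::topological_space \<Rightarrow> complex) set" where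
  "Bc = {\<phi>. \<phi> \<in> borel_measurable borel \<and> bounded (range \<phi>) \<and>
             compact (closure {x. \<phi> x \<noteq> 0})}"

text \<open>The product over x in E of (1 + phi x) to the power N({x}); only finitely many
  factors differ from 1 (points of N inside the compact support of phi).\<close>

definition pgfl_integrand :: "'e::topological_space measure \<Rightarrow> ('e \<Rightarrow> complex) \<Rightarrow> complex" where
  "pgfl_integrand N \<phi> =
     (\<Prod>x\<in>{x. \<phi> x \<noteq> 0 \<and> point_mult N x \<noteq> 0}. (1 + \<phi> x) ^ point_mult N x)"

definition pgfl :: "'e::topological_space measure measure \<Rightarrow> ('e \<Rightarrow> complex) \<Rightarrow> complex" where
  "pgfl P \<phi> = (\<integral>N. pgfl_integrand N \<phi> \<partial>P)"

definition class_C :: "'e::topological_space measure measure \<Rightarrow> bool" where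
  "class_C P \<longleftrightarrow> (\<forall>\<phi>\<in>Bc. integrable P (\<lambda>N. pgfl_integrand N \<phi>))"

definition class_C_non_vanishing :: "'e::topological_space measure measure \<Rightarrow> bool" where
  "class_C_non_vanishing P \<longleftrightarrow>
     class_C P \<and> (\<forall>\<phi>\<in>Bc. \<forall>z::complex. pgfl P (\<lambda>x. z * \<phi> x) \<noteq> 0)"

definition same_zeros :: "(complex \<Rightarrow> complex) \<Rightarrow> (complex \<Rightarrow> complex) \<Rightarrow> bool" where
  "same_zeros f g \<longleftrightarrow>
     (\<forall>z. (f z = 0 \<longleftrightarrow> g z = 0) \<and> (f z = 0 \<longrightarrow> zorder f z = zorder g z))"

definition is_class_C_zero :: "'e::topological_space measure measure set \<Rightarrow> bool" where
  "is_class_C_zero Z \<longleftrightarrow>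
     (\<forall>P\<in>Z. class_C P) \<and>
     (\<forall>P\<in>Z. \<forall>P'\<in>Z. \<forall>\<phi>\<in>Bc.
        same_zeros (\<lambda>z. pgfl P (\<lambda>x. z * \<phi> x)) (\<lambda>z. pgfl P' (\<lambda>x. z * \<phi> x)) \<longrightarrow>
        (\<lambda>z. pgfl P (\<lambda>x. z * \<phi> x)) = (\<lambda>z. pgfl P' (\<lambda>x. z * \<phi> x)))"

end

theory Submission
  imports Defs
begin

text \<open>By independence the generating functionals multiply, so for each test function \<open>\<phi>\<close>
  the entire functions \<open>F z = \<B>\<^sub>\<Theta>(z\<phi>)\<close> and \<open>G z = \<B>\<^sub>\<Xi>(z\<phi>)\<close> satisfy \<open>F G = F' G'\<close> with \<open>F\<close>, \<open>F'\<close>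
  zero-free. Hence \<open>G\<close> and \<open>G'\<close> have the same zeros and coincide, and cancelling \<open>G\<close>, which
  is \<open>1\<close> at \<open>0\<close>, gives \<open>F = F'\<close>. That the generating functional determines the law is seen
  by taking \<open>1 + \<phi> = exp (i t h)\<close> with \<open>h\<close> a step function: this yields the characteristic
  functions of all real linear combinations of counts in relatively compact sets.\<close>

section \<open>Integrals depending holomorphically on a parameter\<close>

text \<open>Differentiation under the integral sign. Cauchy's inequality converts an integrable
  bound for the functions on a disc into the same bound for their derivatives on a smaller disc, so
  the difference quotients are dominated.\<close>

lemma holomorphic_on_integral:
  fixes f :: "complex \<Rightarrow> 'a \<Rightarrow> complex"
  assumes meas: "\<And>z. f z \<in> borel_measurable M"
    and holo: "\<And>x. x \<in> space M \<Longrightarrow> (\<lambda>z. f z x) holomorphic_on UNIV"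
    and bound: "\<And>r. \<exists>g. integrable M g \<and>
      (\<forall>x\<in>space M. \<forall>z. norm z \<le> r \<longrightarrow> norm (f z x) \<le> g x)"
  shows "(\<lambda>z. \<integral>x. f z x \<partial>M) holomorphic_on UNIV"
proof -
  have "(\<lambda>z. \<integral>x. f z x \<partial>M) field_differentiable at w" for w
  proof -
    define F where "F = (\<lambda>z. \<integral>x. f z x \<partial>M)"
    define d where "d = (\<lambda>x. deriv (\<lambda>z. f z x) w)"
    \<comment> \<open>Unit circles centred at points of the closed unit disc about \<open>w\<close>
      stay within distance 2 of \<open>w\<close>. Hence one majorant \<open>g\<close> for radius
      \<open>norm w + 2\<close> serves in all the Cauchy estimates below.\<close>
    obtain g where g: "integrable M g"
      and g_bound: "\<And>x z. x \<in> space M \<Longrightarrow> norm z \<le> norm w + 2 \<Longrightarrow> norm (f z x) \<le> g x"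
      using bound[of "norm w + 2"] by blast
    have int: "integrable M (f z)" if "norm z \<le> norm w + 2" for z
      by (rule Bochner_Integration.integrable_bound[OF g meas])
        (use g_bound that in \<open>fastforce intro: order_trans[OF _ abs_ge_self]\<close>)
    have der: "((\<lambda>z. f z x) has_field_derivative deriv (\<lambda>z. f z x) z) (at z)"
      if "x \<in> space M" for x z
      using holomorphic_derivI[OF holo[OF that] open_UNIV] by simp
    have der_bound: "norm (deriv (\<lambda>z. f z x) z) \<le> g x"
      if "x \<in> space M" "z \<in> cball w 1" for x z
    proof -
      have "norm ((deriv ^^ 1) (\<lambda>z. f z x) z) \<le> fact 1 * g x / 1 ^ 1"
      proof (rule Cauchy_inequality)
        show "(\<lambda>z. f z x) holomorphic_on ball z 1"
          using holo[OF that(1)] by (rule holomorphic_on_subset) simp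
        show "continuous_on (cball z 1) (\<lambda>z. f z x)"
          using holo[OF that(1)] by (meson continuous_on_subset holomorphic_on_imp_continuous_on subset_UNIV)
        fix y assume "norm (z - y) = 1"
        moreover have "norm (w - z) \<le> 1"
          using that(2) by (simp add: dist_norm)
        ultimately have "norm y \<le> norm w + 2"
          using norm_triangle_ineq4[of w "w - y"] norm_triangle_ineq[of "w - z" "z - y"] by simp
        then show "norm (f y x) \<le> g x"
          using g_bound that(1) by blast
      qed simp
      then show ?thesis by simp
    qed
    \<comment> \<open>Mean value inequality on the convex disc: \<open>g x\<close> is an integrable
      Lipschitz constant, and therefore dominates every difference quotient at
      \<open>w\<close>.\<close>
    have lip: "norm (f z x - f w x) \<le> g x * norm (z - w)"
      if "x \<in> space M" "z \<in> cball w 1" for x z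
      using that der der_bound
      by (intro field_differentiable_bound[of "cball w 1" _ "deriv (\<lambda>z. f z x)"])
        (auto intro: has_field_derivative_at_within)
    have "((\<lambda>z. (F z - F w) / (z - w)) \<longlongrightarrow> (\<integral>x. d x \<partial>M)) (at w)"
      unfolding tendsto_at_iff_sequentially
    proof (intro allI impI)
      fix X :: "nat \<Rightarrow> complex"
      assume X: "\<forall>i. X i \<in> UNIV - {w}" and lim: "X \<longlonglongrightarrow> w"
      \<comment> \<open>Dominated convergence works along sequences. Dropping the first
        \<open>k\<close> terms keeps the sequence in the unit disc about \<open>w\<close>, where
        \<open>lip\<close> holds; the limit is unaffected.\<close>
      obtain k where k: "\<And>n. n \<ge> k \<Longrightarrow> dist (X n) w < 1"
        using metric_LIMSEQ_D[OF lim, of 1] by auto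
      define Y where "Y = (\<lambda>n. X (n + k))"
      have Y: "Y n \<noteq> w" "Y n \<in> cball w 1" for n
        using X k[of "n + k"] by (auto simp: Y_def dist_commute)
      have Y_lim: "Y \<longlonglongrightarrow> w"
        using lim unfolding Y_def by (rule LIMSEQ_ignore_initial_segment)
      have Y_norm: "norm (Y n) \<le> norm w + 2" for n
      proof -
        have "norm (w - Y n) \<le> 1"
          using Y(2)[of n] by (simp add: dist_norm)
        then show ?thesis
          using norm_triangle_ineq4[of w "w - Y n"] by simp
      qed
      define q where "q = (\<lambda>n x. (f (Y n) x - f w x) / (Y n - w))"
      have q_meas: "q n \<in> borel_measurable M" for n
        unfolding q_def using meas by measurable
      have q_lim: "(\<lambda>n. q n x) \<longlonglongrightarrow> d x" if "x \<in> space M" for x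
        using der[OF that, of w] Y_lim Y(1)
        unfolding has_field_derivative_iff tendsto_at_iff_sequentially q_def d_def comp_def
        by blast
      have "(\<lambda>n. \<integral>x. q n x \<partial>M) \<longlonglongrightarrow> (\<integral>x. d x \<partial>M)"
      proof (rule integral_dominated_convergence)
        \<comment> \<open>The derivative inherits measurability as a pointwise limit of the
          difference quotients.\<close>
        show "d \<in> borel_measurable M"
          using q_lim q_meas by (rule borel_measurable_LIMSEQ_metric[rotated])
        show "AE x in M. norm (q n x) \<le> g x" for n
        proof (rule AE_I2)
          fix x assume "x \<in> space M"
          from lip[OF this Y(2), of n] show "norm (q n x) \<le> g x"
            using Y(1)[of n] by (simp add: q_def norm_divide divide_le_eq)
        qed
      qed (use g q_meas q_lim in auto)
      moreover have "(\<integral>x. q n x \<partial>M) = (F (Y n) - F w) / (Y n - w)" for n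
        using int[OF Y_norm[of n]] int[of w] by (simp add: q_def F_def)
      ultimately have "(\<lambda>n. (F (X (n + k)) - F w) / (X (n + k) - w)) \<longlonglongrightarrow> (\<integral>x. d x \<partial>M)"
        by (simp add: Y_def)
      then show "((\<lambda>z. (F z - F w) / (z - w)) \<circ> X) \<longlonglongrightarrow> (\<integral>x. d x \<partial>M)"
        unfolding comp_def by (rule LIMSEQ_offset)
    qed
    then show ?thesis
      unfolding F_def field_differentiable_def has_field_derivative_iff by blast
  qed
  then show ?thesis
    by (simp add: holomorphic_on_def)
qed

section \<open>Atoms of integer-valued Radon measures\<close>

context
  fixes N :: "'e::metric_space measure"
  assumes N: "N \<in> counting_radon"
begin

lemma counting_radon_sets: "sets N = sets borel"
  using N by (simp add: counting_radon_def)

lemma counting_radon_emeasure_nat: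
  assumes "A \<in> sets borel" "A \<subseteq> K" "compact K"
  shows "\<exists>n::nat. emeasure N A = of_nat n"
proof -
  have "emeasure N A \<le> emeasure N K"
    using assms by (intro emeasure_mono) (auto simp: counting_radon_sets compact_imp_closed)
  also have "\<dots> < \<infinity>"
    using N assms(3) by (auto simp: counting_radon_def)
  finally show ?thesis
    using N assms(1) by (auto simp: counting_radon_def)
qed

text \<open>Singletons are compact, so their masses are natural numbers and the floor in
  \<open>point_mult\<close> loses nothing.\<close>

lemma emeasure_singleton_point_mult: "emeasure N {x} = of_nat (point_mult N x)"
proof -
  obtain n :: nat where "emeasure N {x} = of_nat n"
    using counting_radon_emeasure_nat[of "{x}" "{x}"] by auto
  then show ?thesis
    by (simp add: point_mult_def measure_def)
qed

lemma emeasure_finite_set: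
  assumes "finite S"
  shows "emeasure N S = of_nat (\<Sum>x\<in>S. point_mult N x)"
  using assms by (subst emeasure_eq_sum_singleton)
    (auto simp: counting_radon_sets emeasure_singleton_point_mult)

text \<open>Each atom has mass at least 1, so more atoms in \<open>K\<close> than the natural number
  \<open>N(K)\<close> would exceed the mass of \<open>K\<close>.\<close>

lemma finite_atoms_compact:
  assumes "compact K"
  shows "finite {x \<in> K. point_mult N x \<noteq> 0}"
proof (rule ccontr)
  assume inf: "infinite {x \<in> K. point_mult N x \<noteq> 0}"
  have K: "K \<in> sets borel"
    using assms by (simp add: compact_imp_closed)
  obtain n :: nat where n: "emeasure N K = of_nat n"
    using counting_radon_emeasure_nat[OF K order_refl assms] by blast
  obtain B where B: "finite B" "card B = Suc n" "B \<subseteq> {x \<in> K. point_mult N x \<noteq> 0}"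
    using infinite_arbitrarily_large[OF inf] by blast
  have "card B \<le> (\<Sum>x\<in>B. point_mult N x)"
    using B by (subst card_eq_sum, intro sum_mono) (auto simp: Suc_le_eq)
  moreover have "emeasure N B \<le> emeasure N K"
    using B(3) K by (intro emeasure_mono) (auto simp: counting_radon_sets)
  ultimately show False
    using B(1,2) n by (simp add: emeasure_finite_set del: of_nat_sum)
qed

text \<open>Integrality rules out a diffuse part: off its finitely many atoms, \<open>K\<close> is
  locally null, and by compactness null.\<close>

lemma emeasure_eq_sum_atoms:
  assumes A: "A \<in> sets borel" "A \<subseteq> K" and K: "compact K"
  shows "emeasure N A = of_nat (\<Sum>x\<in>{x \<in> A. point_mult N x \<noteq> 0}. point_mult N x)"
proof -
  define S where "S = {x \<in> K. point_mult N x \<noteq> 0}"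
  have S: "finite S"
    unfolding S_def using K by (rule finite_atoms_compact)
  have K_sets: "K \<in> sets borel"
    using K by (simp add: compact_imp_closed)
  have S_sets: "S \<in> sets borel"
    using S by (intro borel_closed finite_imp_closed)
  \<comment> \<open>Around each point the balls shrink to a set without atoms, so their integer-valued
    masses outside the atoms are eventually zero.\<close>
  have "\<exists>r>0. emeasure N (ball x r \<inter> (K - S)) = 0" if "x \<in> K" for x
  proof -
    define B where "B = (\<lambda>n. ball x (1 / Suc n) \<inter> (K - S))"
    have B_sets: "B n \<in> sets borel" for n
      unfolding B_def using K_sets S_sets by auto
    have B_nat: "\<exists>m::nat. emeasure N (B n) = of_nat m" for n
      using B_sets by (rule counting_radon_emeasure_nat[OF _ _ K]) (auto simp: B_def)
    have "(\<lambda>n. emeasure N (B n)) \<longlonglongrightarrow> emeasure N (\<Inter>n. B n)"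
    proof (rule Lim_emeasure_decseq)
      show "range B \<subseteq> sets N"
        using B_sets by (auto simp: counting_radon_sets)
      show "decseq B"
        unfolding decseq_def B_def 
        by (auto elim!: less_le_trans intro!: frac_le)
      show "emeasure N (B n) \<noteq> \<infinity>" for n
        using B_nat[of n] by auto
    qed
    moreover have "(\<Inter>n. B n) \<subseteq> {x} - S"
    proof
      fix y assume y: "y \<in> (\<Inter>n. B n)"
      have "y = x"
      proof (rule ccontr)
        assume "y \<noteq> x"
        then obtain n where "1 / real (Suc n) < dist x y"
          using nat_approx_posE[of "dist x y"] by auto
        moreover have "y \<in> ball x (1 / real (Suc n))"
          using y unfolding B_def by blast
        ultimately show False
          by simp
      qed
      with y show "y \<in> {x} - S"
        by (auto simp: B_def)
    qed
    then have "emeasure N (\<Inter>n. B n) \<le> emeasure N ({x} - S)"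
      by (intro emeasure_mono) (use S_sets in \<open>auto simp: counting_radon_sets\<close>)
    moreover have "emeasure N ({x} - S) = 0"
    proof (cases "x \<in> S")
      case True
      then have "{x} - S = {}" by auto
      then show ?thesis by simp
    next
      case False
      with that have "{x} - S = {x}" "point_mult N x = 0"
        by (auto simp: S_def)
      then show ?thesis
        by (simp add: emeasure_singleton_point_mult)
    qed
    ultimately have "(\<lambda>n. emeasure N (B n)) \<longlonglongrightarrow> 0"
      by simp
    then have "eventually (\<lambda>n. emeasure N (B n) < 1) sequentially"
      by (rule order_tendstoD) simp
    then obtain n where n: "emeasure N (B n) < 1"
      by (auto simp: eventually_sequentially)
    obtain m :: nat where "emeasure N (B n) = of_nat m"
      using B_nat by blast
    with n have "emeasure N (B n) = 0"
      using of_nat_less_iff[of m 1, where 'a = ennreal] by simp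
    then show ?thesis
      unfolding B_def by (intro exI[of _ "1 / Suc n"]) auto
  qed
  then obtain r where r: "\<And>x. x \<in> K \<Longrightarrow> r x > 0 \<and> emeasure N (ball x (r x) \<inter> (K - S)) = 0"
    by metis
  have "K \<subseteq> (\<Union>x\<in>K. ball x (r x))"
    using r by force
  \<comment> \<open>Finitely many of the balls cover \<open>K\<close>, so the part of
    \<open>K\<close> outside the atoms lies in a finite union of null sets.\<close>
  then obtain D where D: "D \<subseteq> K" "finite D" "K \<subseteq> (\<Union>x\<in>D. ball x (r x))"
    using compactE_image[OF K, of K "\<lambda>x. ball x (r x)"] by auto
  have "(\<Union>x\<in>D. ball x (r x) \<inter> (K - S)) \<in> null_sets N"
    using D r K_sets S_sets
    by (intro null_sets.finite_UN) (auto intro!: null_setsI simp: counting_radon_sets)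
  moreover have "A - S \<subseteq> (\<Union>x\<in>D. ball x (r x) \<inter> (K - S))"
    using D(3) A(2) by auto
  moreover have "A - S \<in> sets N"
    using A S_sets by (simp add: counting_radon_sets)
  ultimately have null: "A - S \<in> null_sets N"
    by (meson null_sets_subset)
  \<comment> \<open>Discarding the null part \<open>A - S\<close> leaves exactly the atoms in
    \<open>A\<close>.\<close>
  have "emeasure N A = emeasure N (A - (A - S))"
    by (rule emeasure_Diff_null_set[symmetric, OF null]) (use A in \<open>simp add: counting_radon_sets\<close>)
  also have "A - (A - S) = {x \<in> A. point_mult N x \<noteq> 0}"
    using A(2) by (auto simp: S_def)
  also have "emeasure N \<dots> = of_nat (\<Sum>x\<in>{x \<in> A. point_mult N x \<noteq> 0}. point_mult N x)"
    using A(2) by (intro emeasure_finite_set finite_subset[OF _ S]) (auto simp: S_def)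
  finally show ?thesis .
qed

text \<open>Summing over the atoms of the whole compact set, with an indicator, lets several sets
  \<open>A\<close> share one index set.\<close>

lemma measure_eq_sum_atoms:
  assumes A: "A \<in> sets borel" "A \<subseteq> K" and K: "compact K"
  shows "measure N A = (\<Sum>x\<in>{x \<in> K. point_mult N x \<noteq> 0}. indicator A x * real (point_mult N x))"
proof -
  have "measure N A = (\<Sum>x\<in>{x \<in> A. point_mult N x \<noteq> 0}. real (point_mult N x))"
    unfolding measure_def emeasure_eq_sum_atoms[OF assms] by (simp del: of_nat_sum flip: of_nat_sum)
  also have "\<dots> = (\<Sum>x\<in>{x \<in> K. point_mult N x \<noteq> 0}. indicator A x * real (point_mult N x))"
    using A(2) by (intro sum.mono_neutral_cong_left finite_atoms_compact[OF K])
      (auto simp: indicator_def)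
  finally show ?thesis .
qed

end

section \<open>The probability generating functional\<close>

text \<open>A compact set around the support suffices as a witness: the closure of the support is
  then a closed subset of it. This avoids computing closures for concrete test functions.\<close>

lemma Bc_I:
  assumes "\<phi> \<in> borel_measurable borel" "\<And>x. norm (\<phi> x) \<le> C" "compact K" "{x. \<phi> x \<noteq> 0} \<subseteq> K"
  shows "\<phi> \<in> (Bc :: ('e::metric_space \<Rightarrow> complex) set)"
proof -
  have "closure {x. \<phi> x \<noteq> 0} \<subseteq> K"
    using assms by (intro closure_minimal compact_imp_closed)
  then have "compact (K \<inter> closure {x. \<phi> x \<noteq> 0})"
    using assms(3) by (intro compact_Int_closed) auto
  with \<open>closure _ \<subseteq> K\<close> have "compact (closure {x. \<phi> x \<noteq> 0})"
    by (simp add: Int_absorb1)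
  then show ?thesis
    using assms(1,2) by (auto simp: Bc_def intro!: boundedI)
qed

lemma Bc_D:
  assumes "\<phi> \<in> (Bc :: ('e::metric_space \<Rightarrow> complex) set)"
  shows "\<phi> \<in> borel_measurable borel" "\<exists>C. \<forall>x. norm (\<phi> x) \<le> C"
    "\<exists>K. compact K \<and> {x. \<phi> x \<noteq> 0} \<subseteq> K"
  using assms closure_subset[of "{x. \<phi> x \<noteq> 0}"] by (auto simp: Bc_def bounded_iff)

lemma Bc_scale:
  assumes "\<phi> \<in> (Bc :: ('e::metric_space \<Rightarrow> complex) set)"
  shows "(\<lambda>x. z * \<phi> x) \<in> Bc"
proof -
  obtain C K where "\<forall>x. norm (\<phi> x) \<le> C" "compact K" "{x. \<phi> x \<noteq> 0} \<subseteq> K"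
    using Bc_D(2,3)[OF assms] by blast
  with Bc_D(1)[OF assms] show ?thesis
    by (intro Bc_I[of _ "norm z * C" K]) (auto simp: norm_mult intro!: mult_left_mono)
qed

lemma Bc_norm:
  assumes "\<phi> \<in> (Bc :: ('e::metric_space \<Rightarrow> complex) set)"
  shows "(\<lambda>x. of_real (norm (\<phi> x))) \<in> Bc"
proof -
  obtain C K where "\<forall>x. norm (\<phi> x) \<le> C" "compact K" "{x. \<phi> x \<noteq> 0} \<subseteq> K"
    using Bc_D(2,3)[OF assms] by blast
  with Bc_D(1)[OF assms] show ?thesis
    by (intro Bc_I[of _ C K]) auto
qed

text \<open>The added factors equal 1. The gain is a finite index set that depends only on
  \<open>K\<close>, hence stays fixed when \<open>\<phi>\<close> is scaled.\<close>

lemma pgfl_integrand_eq_prod: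
  fixes N :: "'e::metric_space measure"
  assumes N: "N \<in> counting_radon" and K: "compact K" "{x. \<phi> x \<noteq> 0} \<subseteq> K"
  shows "pgfl_integrand N \<phi> = (\<Prod>x\<in>{x \<in> K. point_mult N x \<noteq> 0}. (1 + \<phi> x) ^ point_mult N x)"
  unfolding pgfl_integrand_def
  using K by (intro prod.mono_neutral_left finite_atoms_compact[OF N K(1)]) auto

section \<open>Entire dependence of the generating functional on a scaling parameter\<close>

lemma pgfl_integrand_holomorphic:
  fixes N :: "'e::metric_space measure"
  assumes "N \<in> counting_radon" "\<phi> \<in> Bc"
  shows "(\<lambda>z. pgfl_integrand N (\<lambda>x. z * \<phi> x)) holomorphic_on UNIV"
proof -
  obtain K where K: "compact K" "{x. \<phi> x \<noteq> 0} \<subseteq> K"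
    using Bc_D(3)[OF assms(2)] by blast
  have "pgfl_integrand N (\<lambda>x. z * \<phi> x) =
      (\<Prod>x\<in>{x \<in> K. point_mult N x \<noteq> 0}. (1 + z * \<phi> x) ^ point_mult N x)" for z
    by (rule pgfl_integrand_eq_prod[OF assms(1) K(1)]) (use K(2) in auto)
  then show ?thesis
    by (simp add: holomorphic_intros)
qed

text \<open>Factorwise, \<open>1 + z * \<phi> x\<close> has modulus at most
  \<open>1 + r * norm (\<phi> x)\<close>. The majorant is again an integrand at a test function in
  \<open>Bc\<close>, so \<open>class_C\<close> makes it integrable; this is the domination that
  \<open>holomorphic_on_integral\<close> asks for.\<close>

lemma norm_pgfl_integrand_le:
  fixes N :: "'e::metric_space measure"
  assumes "N \<in> counting_radon" "\<phi> \<in> Bc" "norm z \<le> r"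
  shows "norm (pgfl_integrand N (\<lambda>x. z * \<phi> x)) \<le>
    norm (pgfl_integrand N (\<lambda>x. of_real r * of_real (norm (\<phi> x))))"
proof -
  obtain K where K: "compact K" "{x. \<phi> x \<noteq> 0} \<subseteq> K"
    using Bc_D(3)[OF assms(2)] by blast
  have "norm (1 + z * \<phi> x) \<le> norm (1 + of_real r * of_real (norm (\<phi> x)) :: complex)" for x
  proof -
    have "norm (1 + z * \<phi> x) \<le> 1 + norm z * norm (\<phi> x)"
      by (rule order_trans[OF norm_triangle_ineq]) (simp add: norm_mult)
    also have "\<dots> \<le> 1 + r * norm (\<phi> x)"
      using assms(3) by (simp add: mult_right_mono)
    also have "\<dots> \<le> norm (of_real (1 + r * norm (\<phi> x)) :: complex)"
      unfolding norm_of_real by simp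
    finally show ?thesis by simp
  qed
  then have "norm (\<Prod>x\<in>S. (1 + z * \<phi> x) ^ point_mult N x) \<le>
      norm (\<Prod>x\<in>S. (1 + of_real r * of_real (norm (\<phi> x)) :: complex) ^ point_mult N x)" for S
    unfolding prod_norm[symmetric] norm_power by (intro prod_mono conjI power_mono) auto
  moreover have "{x. z * \<phi> x \<noteq> 0} \<subseteq> K" "{x. of_real r * of_real (norm (\<phi> x)) \<noteq> (0::complex)} \<subseteq> K"
    using K(2) by auto
  ultimately show ?thesis
    unfolding pgfl_integrand_eq_prod[OF assms(1) K(1)] by (simp only: pgfl_integrand_eq_prod[OF assms(1) K(1)])
qed

lemma space_config_space [simp]: "space config_space = counting_radon"
  by (simp add: config_space_def space_measure_of_conv)

lemma pgfl_entire:
  fixes P :: "'e::metric_space measure measure"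
  assumes P: "sets P = sets config_space" "class_C P" and \<phi>: "\<phi> \<in> Bc"
  shows "(\<lambda>z. pgfl P (\<lambda>x. z * \<phi> x)) holomorphic_on UNIV"
proof -
  have space_P: "space P = counting_radon"
    using sets_eq_imp_space_eq[OF P(1)] by simp
  have int: "integrable P (\<lambda>N. pgfl_integrand N \<psi>)" if "\<psi> \<in> Bc" for \<psi>
    using P(2) that by (auto simp: class_C_def)
  show ?thesis
    unfolding pgfl_def
  proof (rule holomorphic_on_integral)
    show "(\<lambda>N. pgfl_integrand N (\<lambda>x. z * \<phi> x)) \<in> borel_measurable P" for z
      using int[OF Bc_scale[OF \<phi>]] by (rule borel_measurable_integrable)
    show "(\<lambda>z. pgfl_integrand N (\<lambda>x. z * \<phi> x)) holomorphic_on UNIV" if "N \<in> space P" for N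
      using that \<phi> by (intro pgfl_integrand_holomorphic) (auto simp: space_P)
    show "\<exists>g. integrable P g \<and> (\<forall>N\<in>space P. \<forall>z. norm z \<le> r \<longrightarrow>
        norm (pgfl_integrand N (\<lambda>x. z * \<phi> x)) \<le> g N)" for r
      using integrable_norm[OF int[OF Bc_scale[OF Bc_norm[OF \<phi>], of "of_real r"]]]
        norm_pgfl_integrand_le[OF _ \<phi>]
      unfolding space_P by blast
  qed
qed

text \<open>The product is empty and the total mass is 1. This normalisation later shows that the
  entire functions in question are not identically zero.\<close>

lemma pgfl_zero:
  assumes "prob_space P"
  shows "pgfl P (\<lambda>x. 0) = 1"
  using assms by (simp add: pgfl_def pgfl_integrand_def prob_space.prob_space)

section \<open>Sums of configurations\<close>

lemma sets_config_add [simp]: "sets (config_add N1 N2) = sets borel"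
  using sets.sigma_sets_eq[of borel] by (simp add: config_add_def sets_measure_of_conv)

text \<open>\<open>measure_of\<close> takes the prescribed values only if they form a measure, so
  positivity and countable additivity of the sum have to be verified first.\<close>

lemma emeasure_config_add:
  assumes "sets N1 = sets borel" "sets N2 = sets borel" "A \<in> sets borel"
  shows "emeasure (config_add N1 N2) A = emeasure N1 A + emeasure N2 A"
  unfolding config_add_def
proof (rule emeasure_measure_of_sigma)
  show "sigma_algebra UNIV (sets (borel :: 'a measure))"
    using sets.sigma_algebra_axioms[of "borel :: 'a measure"] by simp
  show "positive (sets borel) (\<lambda>A. emeasure N1 A + emeasure N2 A)"
    by (simp add: positive_def)
  show "countably_additive (sets borel) (\<lambda>A. emeasure N1 A + emeasure N2 A)"
    unfolding countably_additive_def
  proof (intro allI impI)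
    fix B :: "nat \<Rightarrow> 'a set" assume B: "range B \<subseteq> sets borel" "disjoint_family B"
    have "(\<Sum>i. emeasure N1 (B i) + emeasure N2 (B i)) =
        (\<Sum>i. emeasure N1 (B i)) + (\<Sum>i. emeasure N2 (B i))"
      by (rule suminf_add[symmetric]) (rule summableI)+
    also have "\<dots> = emeasure N1 (\<Union>i. B i) + emeasure N2 (\<Union>i. B i)"
      using B assms(1,2) by (subst (1 2) suminf_emeasure) auto
    finally show "(\<Sum>i. emeasure N1 (B i) + emeasure N2 (B i)) =
        emeasure N1 (\<Union>i. B i) + emeasure N2 (\<Union>i. B i)" .
  qed
qed fact

lemma config_add_counting_radon:
  assumes "N1 \<in> counting_radon" "N2 \<in> counting_radon"
  shows "config_add N1 N2 \<in> (counting_radon :: 'e::metric_space measure set)"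
proof -
  have sets: "sets N1 = sets borel" "sets N2 = sets borel"
    using assms by (auto simp: counting_radon_def)
  note add = emeasure_config_add[OF sets]
  have "\<exists>n::nat. emeasure (config_add N1 N2) A = of_nat n \<or> emeasure (config_add N1 N2) A = \<infinity>"
    if "A \<in> sets borel" for A
  proof -
    have "\<exists>n::nat. emeasure N A = of_nat n \<or> emeasure N A = \<infinity>" if "N \<in> counting_radon" for N
      using that \<open>A \<in> sets borel\<close> unfolding counting_radon_def by blast
    from this[OF assms(1)] this[OF assms(2)]
    obtain m n :: nat where "emeasure N1 A = of_nat m \<or> emeasure N1 A = \<infinity>"
      "emeasure N2 A = of_nat n \<or> emeasure N2 A = \<infinity>"
      by blast
    then show ?thesis
      using that by (intro exI[of _ "m + n"]) (auto simp: add)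
  qed
  then show ?thesis
    using assms by (auto simp: counting_radon_def add compact_imp_closed)
qed

lemma point_mult_config_add:
  assumes "N1 \<in> counting_radon" "N2 \<in> counting_radon"
  shows "point_mult (config_add N1 N2) (x :: 'e::metric_space) = point_mult N1 x + point_mult N2 x"
proof -
  have "(of_nat (point_mult (config_add N1 N2) x) :: ennreal) =
      of_nat (point_mult N1 x) + of_nat (point_mult N2 x)"
    unfolding emeasure_singleton_point_mult[OF assms(1), symmetric] emeasure_singleton_point_mult[OF assms(2), symmetric]
      emeasure_singleton_point_mult[OF config_add_counting_radon[OF assms], symmetric]
    using assms by (intro emeasure_config_add) (auto simp: counting_radon_sets)
  then show ?thesis
    by (metis of_nat_add of_nat_eq_iff)
qed

text \<open>Multiplicities add, so powers multiply, once all three products run over the same finite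
  set \<open>S\<close> of atoms of either configuration.\<close>

lemma pgfl_integrand_config_add:
  fixes N1 N2 :: "'e::metric_space measure"
  assumes N: "N1 \<in> counting_radon" "N2 \<in> counting_radon" and "\<phi> \<in> Bc"
  shows "pgfl_integrand (config_add N1 N2) \<phi> = pgfl_integrand N1 \<phi> * pgfl_integrand N2 \<phi>"
proof -
  obtain K where K: "compact K" "{x. \<phi> x \<noteq> 0} \<subseteq> K"
    using Bc_D(3)[OF assms(3)] by blast
  define S where "S = {x \<in> K. point_mult N1 x \<noteq> 0} \<union> {x \<in> K. point_mult N2 x \<noteq> 0}"
  have S: "finite S"
    unfolding S_def using N K by (simp add: finite_atoms_compact del: neq0_conv)
  have "pgfl_integrand N \<phi> = (\<Prod>x\<in>S. (1 + \<phi> x) ^ point_mult N x)"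
    if "{x \<in> K. point_mult N x \<noteq> 0} \<subseteq> S" for N
    unfolding pgfl_integrand_def using that K(2)
    by (intro prod.mono_neutral_left S) (auto intro!: gr0I)
  then show ?thesis
    using N by (simp add: S_def point_mult_config_add subset_iff power_add prod.distrib)
qed

section \<open>The generating functional determines the law\<close>

lemma config_space_emeasure_measurable:
  assumes "A \<in> sets borel"
  shows "(\<lambda>N. emeasure N A) \<in> borel_measurable (config_space :: 'e::topological_space measure measure)"
proof (rule measurableI)
  fix X :: "ennreal set" assume "X \<in> sets borel"
  then have "{N \<in> counting_radon. emeasure N A \<in> X} \<in> sets (config_space :: 'e measure measure)"
    unfolding config_space_def using assms by (subst sets_measure_of) auto
  also have "{N \<in> counting_radon. emeasure N A \<in> X} =
      (\<lambda>N. emeasure N A) -` X \<inter> space (config_space :: 'e measure measure)"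
    by auto
  finally show "(\<lambda>N. emeasure N A) -` X \<inter> space config_space \<in> sets (config_space :: 'e measure measure)" .
qed simp

lemma measurable_config_spaceI:
  assumes "\<And>x. x \<in> space M \<Longrightarrow> f x \<in> counting_radon"
    and "\<And>A. A \<in> sets borel \<Longrightarrow> (\<lambda>x. emeasure (f x) A) \<in> borel_measurable M"
  shows "f \<in> measurable M (config_space :: 'e::topological_space measure measure)"
  unfolding config_space_def
proof (rule measurable_sigma_sets)
  fix Y :: "'e measure set"
  assume "Y \<in> {{N \<in> counting_radon. emeasure N A \<in> X} | A X. A \<in> sets borel \<and> X \<in> sets borel}"
  then obtain A X where "A \<in> sets borel" "X \<in> sets borel"
    and Y: "Y = {N \<in> counting_radon. emeasure N A \<in> X}"
    by blast
  then have "(\<lambda>x. emeasure (f x) A) -` X \<inter> space M \<in> sets M"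
    using assms(2) by (blast intro: measurable_sets)
  also have "(\<lambda>x. emeasure (f x) A) -` X \<inter> space M = f -` Y \<inter> space M"
    using assms(1) by (auto simp: Y)
  finally show "f -` Y \<inter> space M \<in> sets M" .
qed (use assms(1) in \<open>auto simp: sets_measure_of_conv\<close>)

text \<open>By the Lindelof property countably many open sets with compact hulls cover the space;
  the finite unions of these hulls increase to everything.\<close>

lemma compact_exhaustion:
  assumes "locally_compact_space (euclidean :: 'e::{second_countable_topology, t2_space} topology)"
  obtains K :: "nat \<Rightarrow> 'e::{second_countable_topology, t2_space} set" where "\<And>n. compact (K n)" "incseq K" "(\<Union>n. K n) = UNIV"
proof -
  have "\<forall>x. \<exists>U C. open U \<and> compact C \<and> x \<in> U \<and> U \<subseteq> (C :: 'e set)"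
    using assms by (simp add: locally_compact_space_def)
  then obtain U C where UC: "\<And>x. open (U x)" "\<And>x. compact (C x)" "\<And>x. x \<in> U x"
    "\<And>x. U x \<subseteq> (C x :: 'e set)"
    by metis
  obtain \<U> where \<U>: "\<U> \<subseteq> range U" "countable \<U>" "\<Union>\<U> = \<Union>(range U)"
    using Lindelof[of "range U"] UC(1) by blast
  obtain D where D: "countable D" "\<U> = U ` D"
    using countable_subset_image[of \<U> U UNIV] \<U>(1,2) by auto
  have cover: "(\<Union>x\<in>D. C x) = UNIV"
    using \<U>(3) D(2) UC(3,4) by blast
  \<comment> \<open>Types are inhabited, so a cover of \<open>UNIV\<close> cannot be empty;
    \<open>from_nat_into\<close> enumerates only nonempty sets.\<close>
  then have "D \<noteq> {}" by auto
  define K where "K = (\<lambda>n. \<Union>i\<le>n. C (from_nat_into D i))"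
  show thesis
  proof
    show "compact (K n)" for n
      unfolding K_def using UC(2) by (intro compact_UN) auto
    show "incseq K"
      unfolding K_def incseq_def by (blast intro: order_trans)
    have "(\<Union>n. K n) = (\<Union>i. C (from_nat_into D i))"
      unfolding K_def by auto
    also have "\<dots> = (\<Union>x\<in>D. C x)"
      using range_from_nat_into[OF \<open>D \<noteq> {}\<close> D(1)] by (metis image_image)
    finally show "(\<Union>n. K n) = UNIV"
      using cover by simp
  qed
qed

definition relcompact_sets :: "'e::topological_space set set" where
  "relcompact_sets = {A \<in> sets borel. \<exists>K. compact K \<and> A \<subseteq> K}"

text \<open>Prescribing counts by a relation makes the intersection of two cylinders the cylinder of
  the union; conflicting prescriptions simply give the empty set. Natural numbers suffice as values
  because counts in relatively compact sets are finite.\<close>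

definition count_cylinder :: "('e::topological_space set \<times> nat) set \<Rightarrow> 'e measure set" where
  "count_cylinder F = {N \<in> counting_radon. \<forall>(A, k)\<in>F. emeasure N A = of_nat k}"

definition count_cylinders :: "'e::topological_space measure set set" where
  "count_cylinders = {count_cylinder F | F. finite F \<and> fst ` F \<subseteq> relcompact_sets}"

lemma count_cylinders_subset: "count_cylinders \<subseteq> Pow counting_radon"
  by (auto simp: count_cylinders_def count_cylinder_def)

lemma Int_stable_count_cylinders: "Int_stable count_cylinders"
proof (rule Int_stableI)
  fix X Y :: "'a measure set" assume "X \<in> count_cylinders" "Y \<in> count_cylinders"
  then obtain F G where "finite F" "fst ` F \<subseteq> relcompact_sets" "X = count_cylinder F"
    and "finite G" "fst ` G \<subseteq> relcompact_sets" "Y = count_cylinder G"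
    by (auto simp: count_cylinders_def)
  then show "X \<inter> Y \<in> count_cylinders"
    unfolding count_cylinders_def
    by (intro CollectI exI[of _ "F \<union> G"]) (auto simp: count_cylinder_def)
qed

text \<open>A count in a relatively compact set takes countably many values, so its preimages are
  countable unions of cylinders. For an arbitrary Borel set \<open>A\<close> the count is the
  supremum of the counts in \<open>A \<inter> K n\<close>, where local compactness supplies the
  exhaustion \<open>K\<close>.\<close>

lemma sets_config_space_eq:
  assumes "locally_compact_space (euclidean :: 'e::polish_space topology)"
  shows "sets (config_space :: 'e measure measure) = sigma_sets counting_radon count_cylinders"
proof
  define S where "S = sigma (counting_radon :: 'e measure set) count_cylinders"
  have space_S: "space S = counting_radon" and sets_S: "sets S = sigma_sets counting_radon count_cylinders"
    by (simp_all add: S_def count_cylinders_subset)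
  obtain K :: "nat \<Rightarrow> 'e set" where K: "\<And>n. compact (K n)" "incseq K" "(\<Union>n. K n) = UNIV"
    using compact_exhaustion[OF assms] by blast
  have relcompact: "(\<lambda>N. emeasure N A) \<in> borel_measurable S" if "A \<in> relcompact_sets" for A
  proof (rule measurableI)
    fix X :: "ennreal set" assume "X \<in> sets borel"
    have "\<exists>k::nat. emeasure N A = of_nat k" if "N \<in> counting_radon" for N
      using \<open>A \<in> relcompact_sets\<close> counting_radon_emeasure_nat[OF that] by (auto simp: relcompact_sets_def)
    then have "(\<lambda>N. emeasure N A) -` X \<inter> space S =
        (\<Union>k\<in>{k::nat. of_nat k \<in> X}. count_cylinder {(A, k)})"
      by (fastforce simp: space_S count_cylinder_def)
    moreover have "count_cylinder {(A, k)} \<in> count_cylinders" for k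
      using that unfolding count_cylinders_def by (intro CollectI exI[of _ "{(A, k)}"]) auto
    then have "count_cylinder {(A, k)} \<in> sets S" for k
      unfolding sets_S by (blast intro: sigma_sets.Basic)
    ultimately show "(\<lambda>N. emeasure N A) -` X \<inter> space S \<in> sets S"
      by (auto intro!: sets.countable_UN')
  qed simp
  \<comment> \<open>Measurability of the identity from \<open>S\<close> is the inclusion of the
    sigma-algebras.\<close>
  have "(\<lambda>N. N) \<in> measurable S (config_space :: 'e measure measure)"
  proof (rule measurable_config_spaceI)
    fix A :: "'e set" assume A: "A \<in> sets borel"
    have K_sets: "K n \<in> sets borel" for n
      using K(1) by (simp add: compact_imp_closed)
    have "emeasure N A = (SUP n. emeasure N (A \<inter> K n))" if "N \<in> space S" for N
    proof -
      have sets_N: "sets N = sets borel"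
        using that by (simp add: space_S counting_radon_sets)
      have "incseq (\<lambda>n. A \<inter> K n)"
        using K(2) by (fastforce simp: incseq_def)
      then have "(SUP n. emeasure N (A \<inter> K n)) = emeasure N (\<Union>n. A \<inter> K n)"
        using A K_sets by (intro SUP_emeasure_incseq) (auto simp: sets_N)
      also have "(\<Union>n. A \<inter> K n) = A"
        using K(3) by auto
      finally show ?thesis ..
    qed
    moreover have "A \<inter> K n \<in> relcompact_sets" for n
      using A K(1) K_sets by (auto simp: relcompact_sets_def)
    then have "(\<lambda>N. SUP n. emeasure N (A \<inter> K n)) \<in> borel_measurable S"
      by (intro borel_measurable_SUP relcompact) auto
    ultimately show "(\<lambda>N. emeasure N A) \<in> borel_measurable S"
      by (subst measurable_cong) auto
  qed (simp add: space_S)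
  then have "(\<lambda>N. N) -` X \<inter> space S \<in> sets S" if "X \<in> sets config_space" for X
    using that by (rule measurable_sets)
  moreover have "X \<subseteq> space S" if "X \<in> sets config_space" for X
    using sets.sets_into_space[OF that] by (simp add: space_S)
  ultimately show "sets (config_space :: 'e measure measure) \<subseteq> sigma_sets counting_radon count_cylinders"
    by (auto simp: sets_S Int_absorb2)
next
  have "X \<in> sets config_space" if "X \<in> count_cylinders" for X :: "'e measure set"
  proof -
    obtain F where F: "finite F" "fst ` F \<subseteq> relcompact_sets" "X = count_cylinder F"
      using \<open>X \<in> count_cylinders\<close> by (auto simp: count_cylinders_def)
    have "X = {N \<in> space config_space. \<forall>i\<in>F. emeasure N (fst i) = of_nat (snd i)}"
      by (auto simp: F(3) count_cylinder_def)
    also have "\<dots> \<in> sets config_space"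
    proof (rule sets.sets_Collect_finite_All[OF _ F(1)])
      fix i assume "i \<in> F"
      then have "fst i \<in> sets borel"
        using F(2) by (auto simp: relcompact_sets_def)
      then have "(\<lambda>N. emeasure N (fst i)) -` {of_nat (snd i)} \<inter> space config_space
          \<in> sets (config_space :: 'e measure measure)"
        by (intro measurable_sets[OF config_space_emeasure_measurable]) auto
      also have "(\<lambda>N. emeasure N (fst i)) -` {of_nat (snd i)} \<inter> space config_space =
          {N \<in> space config_space. emeasure N (fst i) = of_nat (snd i)}"
        by auto
      finally show "{N \<in> space config_space. emeasure N (fst i) = of_nat (snd i)}
          \<in> sets (config_space :: 'e measure measure)" .
    qed
    finally show ?thesis .
  qed
  then show "sigma_sets counting_radon count_cylinders \<subseteq> sets (config_space :: 'e measure measure)"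
    using sets.sigma_sets_subset[of count_cylinders "config_space :: 'e measure measure"]
    by (auto simp: subset_iff)
qed

section \<open>Counts encoded in one real variable, and its characteristic function\<close>

lemma sum_ln_primes_inject:
  fixes p :: "'i \<Rightarrow> nat"
  assumes I: "finite I" "inj_on p I" "\<And>i. i \<in> I \<Longrightarrow> prime (p i)"
    and eq: "(\<Sum>i\<in>I. ln (real (p i)) * real (m i)) = (\<Sum>i\<in>I. ln (real (p i)) * real (n i))"
    and "i \<in> I"
  shows "m i = n i"
proof -
  have pos: "p i > 0" if "i \<in> I" for i
    using I(3)[OF that] by (rule prime_gt_0_nat)
  \<comment> \<open>Each sum is the logarithm of a product of prime powers, so equal sums give equal
    integers and unique factorisation returns the exponents.\<close>
  have ln_prod: "(\<Sum>i\<in>I. ln (real (p i)) * real (k i)) = ln (real (\<Prod>i\<in>I. p i ^ k i))" for k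
    using I(1) pos by (simp add: ln_prod ln_realpow mult.commute)
  have "(\<Prod>i\<in>I. p i ^ m i) = (\<Prod>i\<in>I. p i ^ n i)"
    using eq pos unfolding ln_prod by (subst (asm) ln_inj_iff) (auto simp flip: of_nat_prod of_nat_power intro!: prod_pos)
  moreover have "multiplicity (p i) (\<Prod>i\<in>I. p i ^ k i) = k i" for k
  proof -
    \<comment> \<open>Reindexing by the primes themselves, possible since \<open>p\<close> is
      injective, gives the form in which multiplicities can be read off.\<close>
    have "(\<Prod>i\<in>I. p i ^ k i) = (\<Prod>q\<in>p ` I. q ^ k (inv_into I p q))"
      using I(2) by (simp add: prod.reindex)
    then show ?thesis
      using I(1) \<open>i \<in> I\<close> I(2,3)
      by (simp only:, subst multiplicity_prod_prime_powers) auto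
  qed
  ultimately show ?thesis
    by metis
qed

text \<open>For \<open>1 + \<phi> = iexp (t * h)\<close> the product over atoms is the exponential
  of the integral of \<open>h\<close> against \<open>N\<close>, here a linear combination of
  counts.\<close>

lemma pgfl_integrand_iexp:
  fixes N :: "'e::metric_space measure"
  assumes N: "N \<in> counting_radon" and F: "finite F" "fst ` F \<subseteq> relcompact_sets"
  shows "pgfl_integrand N (\<lambda>x. iexp (t * (\<Sum>i\<in>F. s i * indicator (fst i) x)) - 1) =
    iexp (t * (\<Sum>i\<in>F. s i * measure N (fst i)))"
proof -
  have "\<forall>i\<in>F. \<exists>C. compact C \<and> fst i \<subseteq> C"
    using F(2) by (auto simp: relcompact_sets_def)
  then obtain C where C: "\<And>i. i \<in> F \<Longrightarrow> compact (C i) \<and> fst i \<subseteq> C i"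
    by metis
  define K where "K = (\<Union>i\<in>F. C i)"
  have K: "compact K" "\<And>i. i \<in> F \<Longrightarrow> fst i \<subseteq> K"
    using F(1) C by (auto simp: K_def intro!: compact_UN)
  define T where "T = {x \<in> K. point_mult N x \<noteq> 0}"
  define h where "h = (\<lambda>x. \<Sum>i\<in>F. s i * indicator (fst i) x)"
  have T: "finite T"
    unfolding T_def using N K(1) by (rule finite_atoms_compact)
  have h_0: "h x = 0" if "x \<notin> K" for x
  proof -
    have "x \<notin> fst i" if "i \<in> F" for i
      using K(2)[OF that] \<open>x \<notin> K\<close> by blast
    then show ?thesis
      by (simp add: h_def)
  qed
  have "pgfl_integrand N (\<lambda>x. iexp (t * h x) - 1) = (\<Prod>x\<in>T. (1 + (iexp (t * h x) - 1)) ^ point_mult N x)"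
    unfolding T_def
  proof (rule pgfl_integrand_eq_prod[OF N K(1)])
    have "iexp (t * h x) - 1 = 0" if "x \<notin> K" for x
      using h_0[OF that] by simp
    then show "{x. iexp (t * h x) - 1 \<noteq> 0} \<subseteq> K"
      by blast
  qed
  also have "\<dots> = (\<Prod>x\<in>T. iexp (t * (real (point_mult N x) * h x)))"
    by (intro prod.cong refl) (simp add: exp_of_nat_mult[symmetric] mult_ac)
  also have "\<dots> = iexp (t * (\<Sum>x\<in>T. real (point_mult N x) * h x))"
    by (simp add: exp_sum[OF T] sum_distrib_left)
  \<comment> \<open>Exchanging the sums over atoms and over \<open>F\<close> collects, for each
    \<open>i\<close>, the atoms lying in \<open>fst i\<close>.\<close>
  also have "(\<Sum>x\<in>T. real (point_mult N x) * h x) =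
      (\<Sum>i\<in>F. s i * (\<Sum>x\<in>T. indicator (fst i) x * real (point_mult N x)))"
    unfolding h_def sum_distrib_left by (subst sum.swap) (simp add: mult_ac)
  also have "\<dots> = (\<Sum>i\<in>F. s i * measure N (fst i))"
    using F(2) K(2) unfolding T_def
    by (intro sum.cong refl, subst measure_eq_sum_atoms[OF N _ _ K(1)]) (auto simp: relcompact_sets_def)
  finally show ?thesis
    unfolding h_def .
qed

lemma iexp_indicator_Bc:
  assumes F: "finite F" "fst ` F \<subseteq> relcompact_sets"
  shows "(\<lambda>x. iexp (t * (\<Sum>i\<in>F. s i * indicator (fst i) x)) - 1) \<in> (Bc :: ('e::metric_space \<Rightarrow> complex) set)"
proof -
  have "\<forall>i\<in>F. \<exists>C. compact C \<and> fst i \<subseteq> C"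
    using F(2) by (auto simp: relcompact_sets_def)
  then obtain C where C: "\<And>i. i \<in> F \<Longrightarrow> compact (C i) \<and> fst i \<subseteq> C i"
    by metis
  show ?thesis
  proof (rule Bc_I)
    have "(\<lambda>x. \<Sum>i\<in>F. s i * indicator (fst i) x :: real) \<in> borel_measurable borel"
      using F(2) by (intro borel_measurable_sum borel_measurable_times borel_measurable_indicator)
        (auto simp: relcompact_sets_def)
    then show "(\<lambda>x. iexp (t * (\<Sum>i\<in>F. s i * indicator (fst i) x)) - 1) \<in> borel_measurable borel"
      by measurable
    show "norm (iexp (t * (\<Sum>i\<in>F. s i * indicator (fst i) x)) - 1) \<le> 2" for x
      by (rule order_trans[OF norm_triangle_ineq4]) simp
    show "compact (\<Union>i\<in>F. C i)"
      using F(1) C by (intro compact_UN) auto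
    have sum_0: "(\<Sum>i\<in>F. s i * indicator (fst i) x) = 0" if "x \<notin> (\<Union>i\<in>F. C i)" for x
      using C that by (intro sum.neutral) (auto simp: indicator_def)
    have "iexp (t * (\<Sum>i\<in>F. s i * indicator (fst i) x)) - 1 = 0" if "x \<notin> (\<Union>i\<in>F. C i)" for x
      by (simp only: sum_0[OF that]) simp
    then show "{x. iexp (t * (\<Sum>i\<in>F. s i * indicator (fst i) x)) - 1 \<noteq> 0} \<subseteq> (\<Union>i\<in>F. C i)"
      by blast
  qed
qed

text \<open>It suffices to compare the two laws on cylinders. Each cylinder is a level set of a
  single real random variable whose characteristic function is a value of the generating functional,
  so Levy's uniqueness theorem applies.\<close>

lemma pgfl_determines_law:
  fixes P Q :: "'e::polish_space measure measure"
  assumes lc: "locally_compact_space (euclidean :: 'e topology)"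
    and P: "prob_space P" "sets P = sets config_space"
    and Q: "prob_space Q" "sets Q = sets config_space"
    and eq: "\<And>\<phi>. \<phi> \<in> Bc \<Longrightarrow> pgfl P \<phi> = pgfl Q \<phi>"
  shows "P = Q"
proof (rule measure_eqI_generator_eq[OF Int_stable_count_cylinders count_cylinders_subset,
      where A = "\<lambda>_. counting_radon"])
  show "sets P = sigma_sets counting_radon count_cylinders"
    "sets Q = sigma_sets counting_radon count_cylinders"
    using P(2) Q(2) sets_config_space_eq[OF lc] by auto
  \<comment> \<open>With no prescriptions the cylinder is the whole space, so a constant sequence
    exhausts it.\<close>
  have "counting_radon = count_cylinder ({} :: ('e set \<times> nat) set)"
    by (simp add: count_cylinder_def)
  then show "range (\<lambda>_::nat. counting_radon :: 'e measure set) \<subseteq> count_cylinders"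
    by (auto simp: count_cylinders_def)
  show "emeasure P counting_radon \<noteq> \<infinity>"
    using P(1) by (simp add: finite_measure.emeasure_finite prob_space.axioms(1))
next
  fix X :: "'e measure set" assume "X \<in> count_cylinders"
  then obtain F where F: "finite F" "fst ` F \<subseteq> relcompact_sets" "X = count_cylinder F"
    by (auto simp: count_cylinders_def)
  obtain p :: "'e set \<times> nat \<Rightarrow> nat" where p: "inj_on p F" "\<And>i. i \<in> F \<Longrightarrow> prime (p i)"
  proof -
    obtain R :: "nat set" where R: "finite R" "card R = card F" "R \<subseteq> {q. prime q}"
      using infinite_arbitrarily_large[OF primes_infinite] by blast
    then obtain p where "bij_betw p F R"
      using finite_same_card_bij[OF F(1) R(1)] by auto
    with R(3) show ?thesis
      by (intro that[of p]) (auto simp: bij_betw_def)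
  qed
  \<comment> \<open>The logarithms of distinct primes are linearly independent over the rationals, so the
    single real variable \<open>Y\<close> encodes all the counts and one-dimensional uniqueness suffices.\<close>
  define Y where "Y = (\<lambda>N :: 'e measure. \<Sum>i\<in>F. ln (real (p i)) * measure N (fst i))"
  define y where "y = (\<Sum>i\<in>F. ln (real (p i)) * real (snd i))"
  have "(\<lambda>N. measure N (fst i)) \<in> borel_measurable (config_space :: 'e measure measure)" if "i \<in> F" for i
  proof -
    have "fst i \<in> sets borel"
      using F(2) that by (auto simp: relcompact_sets_def)
    from config_space_emeasure_measurable[OF this] show ?thesis
      unfolding measure_def by (rule borel_measurable_enn2real)
  qed
  then have Y_meas: "Y \<in> borel_measurable config_space"
    unfolding Y_def by (intro borel_measurable_sum borel_measurable_times borel_measurable_const)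
  \<comment> \<open>On configurations the counts are natural numbers, so injectivity of the prime
    encoding makes \<open>Y N = y\<close> equivalent to all prescriptions at once.\<close>
  have X_eq: "X = Y -` {y} \<inter> counting_radon"
  proof -
    have "(\<forall>(A, k)\<in>F. emeasure N A = of_nat k) \<longleftrightarrow> Y N = y" if N: "N \<in> counting_radon" for N
    proof -
      have "\<forall>i\<in>F. \<exists>m::nat. emeasure N (fst i) = of_nat m"
        proof
        fix i assume "i \<in> F"
        with F(2) obtain C where "fst i \<in> sets borel" "fst i \<subseteq> C" "compact C"
          by (auto simp: relcompact_sets_def)
        then show "\<exists>m::nat. emeasure N (fst i) = of_nat m"
          by (rule counting_radon_emeasure_nat[OF N])
      qed
      then obtain m :: "'e set \<times> nat \<Rightarrow> nat" where m: "\<And>i. i \<in> F \<Longrightarrow> emeasure N (fst i) = of_nat (m i)"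
        by metis
      have "Y N = (\<Sum>i\<in>F. ln (real (p i)) * real (m i))"
        by (simp add: Y_def measure_def m)
      then have "Y N = y \<longleftrightarrow> (\<forall>i\<in>F. m i = snd i)"
        using sum_ln_primes_inject[OF F(1) p, of m snd] by (auto simp: y_def)
      then show ?thesis
        using m by (auto simp: split_beta)
    qed
    then show ?thesis
      by (auto simp: F(3) count_cylinder_def)
  qed
  have char: "char (distr R borel Y) t =
      pgfl R (\<lambda>x. iexp (t * (\<Sum>i\<in>F. ln (real (p i)) * indicator (fst i) x)) - 1)"
    and dist: "real_distribution (distr R borel Y)"
    and law: "emeasure R X = emeasure (distr R borel Y) {y}"
    if R: "prob_space R" "sets R = sets config_space" for R t
  proof -
    have space_R: "space R = counting_radon"
      using sets_eq_imp_space_eq[OF R(2)] by simp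
    have Y_R: "Y \<in> borel_measurable R"
      using Y_meas measurable_cong_sets[OF R(2) refl] by blast
    show "real_distribution (distr R borel Y)"
      using prob_space.real_distribution_distr[OF R(1)] Y_R by simp
    show "emeasure R X = emeasure (distr R borel Y) {y}"
      using Y_R by (simp add: emeasure_distr space_R X_eq)
    have "char (distr R borel Y) t = (\<integral>N. iexp (t * Y N) \<partial>R)"
      unfolding char_def using Y_R by (subst integral_distr) auto
    also have "\<dots> = pgfl R (\<lambda>x. iexp (t * (\<Sum>i\<in>F. ln (real (p i)) * indicator (fst i) x)) - 1)"
      unfolding pgfl_def Y_def
      by (intro Bochner_Integration.integral_cong refl pgfl_integrand_iexp[symmetric])
        (use F in \<open>auto simp: space_R\<close>)
    finally show "char (distr R borel Y) t =
        pgfl R (\<lambda>x. iexp (t * (\<Sum>i\<in>F. ln (real (p i)) * indicator (fst i) x)) - 1)" .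
  qed
  have "char (distr P borel Y) = char (distr Q borel Y)"
    using char[OF P] char[OF Q] eq[OF iexp_indicator_Bc[OF F(1,2)]] by auto
  then have "distr P borel Y = distr Q borel Y"
    by (rule Levy_uniqueness[OF dist[OF P] dist[OF Q]])
  then show "emeasure P X = emeasure Q X"
    using law[OF P] law[OF Q] by simp
qed auto

section \<open>Superpositions\<close>

lemma config_add_measurable:
  fixes X Y :: "'a \<Rightarrow> 'e::metric_space measure"
  assumes X: "X \<in> measurable M config_space" and Y: "Y \<in> measurable M config_space"
  shows "(\<lambda>\<omega>. config_add (X \<omega>) (Y \<omega>)) \<in> measurable M config_space"
proof (rule measurable_config_spaceI)
  have XY: "X \<omega> \<in> counting_radon" "Y \<omega> \<in> counting_radon" if "\<omega> \<in> space M" for \<omega>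
    using measurable_space[OF X that] measurable_space[OF Y that] by simp_all
  then show "config_add (X \<omega>) (Y \<omega>) \<in> counting_radon" if "\<omega> \<in> space M" for \<omega>
    using that by (intro config_add_counting_radon)
  fix A :: "'e set" assume A: "A \<in> sets borel"
  have "(\<lambda>\<omega>. emeasure (X \<omega>) A + emeasure (Y \<omega>) A) \<in> borel_measurable M"
    using measurable_compose[OF X config_space_emeasure_measurable[OF A]]
      measurable_compose[OF Y config_space_emeasure_measurable[OF A]]
    by (rule borel_measurable_add)
  also have "?this \<longleftrightarrow> (\<lambda>\<omega>. emeasure (config_add (X \<omega>) (Y \<omega>)) A) \<in> borel_measurable M"
    using XY A by (intro measurable_cong) (simp add: emeasure_config_add counting_radon_sets)
  finally show "(\<lambda>\<omega>. emeasure (config_add (X \<omega>) (Y \<omega>)) A) \<in> borel_measurable M" .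
qed

lemma (in prob_space) pgfl_distr_config_add:
  fixes X Y :: "'a \<Rightarrow> 'e::metric_space measure"
  assumes X: "X \<in> measurable M config_space" and Y: "Y \<in> measurable M config_space"
    and indep: "indep_var config_space X config_space Y"
    and C: "class_C (distr M config_space X)" "class_C (distr M config_space Y)"
    and \<phi>: "\<phi> \<in> Bc"
  shows "pgfl (distr M config_space (\<lambda>\<omega>. config_add (X \<omega>) (Y \<omega>))) \<phi> =
    pgfl (distr M config_space X) \<phi> * pgfl (distr M config_space Y) \<phi>"
proof -
  let ?g = "\<lambda>N. pgfl_integrand N \<phi>"
  have int: "integrable (distr M config_space X) ?g" "integrable (distr M config_space Y) ?g"
    using C \<phi> by (auto simp: class_C_def)
  \<comment> \<open>Measurability of the integrand comes with the integrability contained in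
    \<open>class_C\<close>.\<close>
  have g: "?g \<in> borel_measurable config_space"
    using borel_measurable_integrable[OF int(1)] by simp
  have "pgfl (distr M config_space (\<lambda>\<omega>. config_add (X \<omega>) (Y \<omega>))) \<phi> =
      (\<integral>\<omega>. ?g (config_add (X \<omega>) (Y \<omega>)) \<partial>M)"
    unfolding pgfl_def by (rule integral_distr[OF config_add_measurable[OF X Y] g])
  also have "\<dots> = (\<integral>\<omega>. ?g (X \<omega>) * ?g (Y \<omega>) \<partial>M)"
    using measurable_space[OF X] measurable_space[OF Y] \<phi>
    by (intro Bochner_Integration.integral_cong refl pgfl_integrand_config_add) simp_all
  also have "\<dots> = (\<integral>\<omega>. ?g (X \<omega>) \<partial>M) * (\<integral>\<omega>. ?g (Y \<omega>) \<partial>M)"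
    using indep_var_compose[OF indep g g] int X Y g
    by (intro indep_var_lebesgue_integral) (auto simp: comp_def integrable_distr_eq)
  also have "\<dots> = pgfl (distr M config_space X) \<phi> * pgfl (distr M config_space Y) \<phi>"
    unfolding pgfl_def by (simp add: integral_distr[OF X g] integral_distr[OF Y g])
  finally show ?thesis .
qed

section \<open>Zeros and cancellation in products of entire functions\<close>

lemma same_zeros_if_nonvanishing_factors:
  assumes holo: "F holomorphic_on UNIV" "F' holomorphic_on UNIV" "G holomorphic_on UNIV" "G' holomorphic_on UNIV"
    and nz: "\<And>z. F z \<noteq> 0" "\<And>z. F' z \<noteq> 0" and "G w \<noteq> 0"
    and eq: "\<And>z. F z * G z = F' z * G' z"
  shows "same_zeros G G'"
proof -
  \<comment> \<open>Orders add under multiplication, and a zero-free factor has order 0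
    everywhere.\<close>
  have order: "zorder (\<lambda>z. A z * B z) z = zorder B z"
    if "A holomorphic_on UNIV" "B holomorphic_on UNIV" "\<And>z. A z \<noteq> 0" "B w \<noteq> 0" for A B z
  proof -
    have an: "A analytic_on {z}" "B analytic_on {z}"
      using that(1,2) by (auto simp: analytic_on_open[symmetric] intro: analytic_on_subset)
    \<comment> \<open>Identity theorem: as \<open>B\<close> is not identically zero on the connected
      plane, its zeros are isolated, which additivity of orders requires.\<close>
    have "eventually (\<lambda>z. B z \<noteq> 0) (at z)"
      using non_zero_neighbour_alt[OF that(2) open_UNIV connected_UNIV _ _ that(4), of z]
      by (auto elim: eventually_mono)
    then have "zorder (\<lambda>z. A z * B z) z = zorder A z + zorder B z"
      using that(3) by (intro zorder_times_analytic an) simp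
    also have "zorder A z = 0"
      using an(1) that(3) by (rule zorder_eq_0I)
    finally show ?thesis by simp
  qed
  have "G' w \<noteq> 0"
    using eq[of w] nz(1)[of w] \<open>G w \<noteq> 0\<close> by auto
  have "G z = 0 \<longleftrightarrow> G' z = 0" for z
    using eq[of z] nz(1)[of z] nz(2)[of z] by (metis mult_eq_0_iff)
  moreover have "zorder G z = zorder G' z" for z
    using order[OF holo(1,3) nz(1) \<open>G w \<noteq> 0\<close>, of z] order[OF holo(2,4) nz(2) \<open>G' w \<noteq> 0\<close>, of z]
    by (simp add: eq)
  ultimately show ?thesis
    by (simp add: same_zeros_def)
qed

text \<open>Division by \<open>G\<close> is possible off its zeros, a nonempty open set; analytic
  continuation extends the equality across the zeros.\<close>

lemma holomorphic_mult_cancel: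
  assumes "F holomorphic_on UNIV" "F' holomorphic_on UNIV" "G holomorphic_on UNIV"
    and "G w \<noteq> 0" and eq: "\<And>z. F z * G z = F' z * G z"
  shows "F z = F' z"
proof (rule analytic_continuation_open[where f = F and g = F' and s = "{z. G z \<noteq> 0}" and s' = UNIV])
  show "open {z. G z \<noteq> 0}"
    using holomorphic_on_imp_continuous_on[OF assms(3)] by (intro open_Collect_neq) auto
  show "{z. G z \<noteq> 0} \<noteq> {}"
    using \<open>G w \<noteq> 0\<close> by blast
  show "F z = F' z" if "z \<in> {z. G z \<noteq> 0}" for z
    using eq[of z] that by simp
qed (use assms(1,2) in auto)

theorem theorem2p5:
  fixes M :: "'a measure" and M' :: "'b measure"
    and \<Theta> \<Xi> :: "'a \<Rightarrow> 'e::polish_space measure"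
    and \<Theta>' \<Xi>' :: "'b \<Rightarrow> 'e measure"
    and Z :: "'e measure measure set"
  assumes "locally_compact_space (euclidean :: 'e topology)"
    and "prob_space M" and "prob_space M'"
    and "\<Theta> \<in> measurable M config_space" and "\<Xi> \<in> measurable M config_space"
    and "\<Theta>' \<in> measurable M' config_space" and "\<Xi>' \<in> measurable M' config_space"
    and "prob_space.indep_var M config_space \<Theta> config_space \<Xi>"
    and "prob_space.indep_var M' config_space \<Theta>' config_space \<Xi>'"
    and "is_class_C_zero Z"
    and "class_C_non_vanishing (distr M config_space \<Theta>)"
    and "class_C_non_vanishing (distr M' config_space \<Theta>')"
    and "distr M config_space \<Xi> \<in> Z"
    and "distr M' config_space \<Xi>' \<in> Z"
    and "distr M config_space (\<lambda>\<omega>. config_add (\<Theta> \<omega>) (\<Xi> \<omega>)) =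
         distr M' config_space (\<lambda>\<omega>. config_add (\<Theta>' \<omega>) (\<Xi>' \<omega>))"
  shows "distr M config_space \<Theta> = distr M' config_space \<Theta>'
       \<and> distr M config_space \<Xi> = distr M' config_space \<Xi>'"
proof -
  let ?T = "distr M config_space \<Theta>" and ?T' = "distr M' config_space \<Theta>'"
  let ?X = "distr M config_space \<Xi>" and ?X' = "distr M' config_space \<Xi>'"
  have prob: "prob_space ?T" "prob_space ?T'" "prob_space ?X" "prob_space ?X'"
    using assms(2-7) by (auto intro: prob_space.prob_space_distr)
  have C: "class_C ?T" "class_C ?T'" "class_C ?X" "class_C ?X'"
    using assms(10-14) by (auto simp: class_C_non_vanishing_def is_class_C_zero_def)
  have "pgfl ?T \<phi> = pgfl ?T' \<phi> \<and> pgfl ?X \<phi> = pgfl ?X' \<phi>" if \<phi>: "\<phi> \<in> Bc" for \<phi>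
  proof -
    define F F' G G' where "F z = pgfl ?T (\<lambda>x. z * \<phi> x)" and "F' z = pgfl ?T' (\<lambda>x. z * \<phi> x)"
      and "G z = pgfl ?X (\<lambda>x. z * \<phi> x)" and "G' z = pgfl ?X' (\<lambda>x. z * \<phi> x)" for z
    have holo: "F holomorphic_on UNIV" "F' holomorphic_on UNIV" "G holomorphic_on UNIV" "G' holomorphic_on UNIV"
      unfolding F_def F'_def G_def G'_def using C \<phi> by (auto intro!: pgfl_entire)
    have nz: "F z \<noteq> 0" "F' z \<noteq> 0" for z
      using assms(11,12) \<phi> by (auto simp: F_def F'_def class_C_non_vanishing_def)
    \<comment> \<open>At parameter 0 the test function is zero and the functional equals 1.\<close>
    have "G 0 \<noteq> 0"
      using pgfl_zero[OF prob(3)] by (simp add: G_def)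
    have eq: "F z * G z = F' z * G' z" for z
      unfolding F_def F'_def G_def G'_def
      using prob_space.pgfl_distr_config_add[OF assms(2,4,5,8) C(1,3) Bc_scale[OF \<phi>, of z]]
        prob_space.pgfl_distr_config_add[OF assms(3,6,7,9) C(2,4) Bc_scale[OF \<phi>, of z]] assms(15)
      by simp
    have "same_zeros G G'"
      using holo nz \<open>G 0 \<noteq> 0\<close> eq by (rule same_zeros_if_nonvanishing_factors)
    \<comment> \<open>Both laws of the second summands lie in \<open>Z\<close>, so its comparison
      property applies to them at this \<open>\<phi>\<close>.\<close>
    then have G: "G = G'"
      using assms(10,13,14) \<phi> unfolding is_class_C_zero_def G_def G'_def by blast
    \<comment> \<open>Parameter 1 gives back \<open>\<phi>\<close> itself, the value needed for
      uniqueness of the laws.\<close>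
    have "F 1 = F' 1"
      using holo(1-3) \<open>G 0 \<noteq> 0\<close> eq unfolding G[symmetric] by (rule holomorphic_mult_cancel)
    moreover have "G 1 = G' 1"
      by (simp add: G)
    ultimately show ?thesis
      by (simp add: F_def F'_def G_def G'_def)
  qed
  then show ?thesis
    using prob by (intro conjI pgfl_determines_law[OF assms(1)]) simp_all
qed

end
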